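(* Let $x_0\in\operatorname{dom}h$, $z_1=f'(x_0)$, and the sequence $\{\tau_j\}_{j\ge1}\subset[0,1]$ be given. Then PDCP$(x_0)$ with the one-cut update for solving the proximal subproblem $\min_u\phi^\lambda(u)$, and CG$(z_1)$ for solving the dual problem $\min_z\psi(z)$ (both with the same $\lambda$ and the same $\{\tau_j\}$), have the following correspondence for every $j\ge1$: $$s_j=z_j,\qquad x_j=\nabla(h^\lambda)^*(-z_j),\qquad f'(x_j)=\bar z_j.$$
   Context: Problem. $f,h:\mathbb R^n\to\mathbb R\cup\{+\infty\}$ are proper lower semicontinuous convex functions with $\operatorname{dom}h\subset\operatorname{dom}f$, $\phi=f+h$. Assumptions: there is a map (subgradient oracle) $f':\operatorname{dom}h\to\mathbb R^n$ with $f'(x)\in\partial f(x)$ for all $x\in\operatorname{dom}h$; $\|f'(x)\|\le M$ for all $x\in\operatorname{dom}h$, for some $M>0$; $\phi$ has a minimizer. Write $\ell_f(u;y)=f(y)+\langle f'(y),u-y\rangle$; $g^*$ is the convex conjugate of $g$. For a fixed prox center $x_0$ and prox stepsize $\lambda>0$, let $h^\lambda(u)=h(u)+\frac1{2\lambda}\|u-x_0\|^2$. The proximal subproblem is $\min_u\{\phi^\lambda(u)=f(u)+h^\lambda(u)\}$ and its dual is $\min_z\{\psi(z)=(h^\lambda)^*(-z)+f^*(z)\}$. PDCP$(x_0)$ with one-cut update (primal-dual cutting-plane scheme, stopping test ignored): $\Gamma_1=\ell_f(\cdot;x_0)$; for $j\ge1$, $x_j=\operatorname{argmin}_u\{\Gamma_j(u)+h^\lambda(u)\}$,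 $s_j\in\partial\Gamma_j(x_j)\cap(-\partial h^\lambda(x_j))$ (since $\Gamma_j$ is affine, $s_j=\nabla\Gamma_j$), and $\Gamma_{j+1}=\tau_j\Gamma_j+(1-\tau_j)\ell_f(\cdot;x_j)$. CG$(z_1)$ (conditional gradient method for the dual problem): for $j\ge1$, $\bar z_j=\operatorname{argmin}_{z\in\mathbb R^n}\{\langle-\nabla(h^\lambda)^*(-z_j),z\rangle+f^*(z)\}$ and $z_{j+1}=\tau_jz_j+(1-\tau_j)\bar z_j$.
   Formalization: The minimizer defining z̄_j need not be unique, and the claim fails for arbitrary choices; here CG is assumed to choose f'(∇(h^λ)*(−z_j)) whenever that point is a minimizer, and such a CG run is shown to exist. *)

theory Defs
  imports "HOL-Analysis.Analysis"
begin

text \<open>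
  Functions into \<open>\<real> \<union> {+\<infinity>}\<close> are rendered as \<^typ>\<open>ereal\<close>-valued functions; the value
  \<open>-\<infinity>\<close> is excluded by properness.
\<close>

definition effective_domain :: "('a \<Rightarrow> ereal) \<Rightarrow> 'a set" where
  "effective_domain g = {x. g x < \<infinity>}"

definition proper :: "('a \<Rightarrow> ereal) \<Rightarrow> bool" where
  "proper g \<longleftrightarrow> (\<forall>x. g x \<noteq> -\<infinity>) \<and> effective_domain g \<noteq> {}"

definition lower_semicontinuous :: "('a::topological_space \<Rightarrow> ereal) \<Rightarrow> bool" where
  "lower_semicontinuous g \<longleftrightarrow> (\<forall>x. g x \<le> Liminf (at x) g)"

text \<open>
  The inequality of \<^const>\<open>convex_on\<close>, which covers real-valued functions only. It is meant for
  functions that never take the value \<open>-\<infinity>\<close>; the convention \<open>0 * \<infinity> = 0\<close> makes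
  the cases \<open>u = 0\<close> and \<open>v = 0\<close> trivial.
\<close>

definition ereal_convex :: "('a::real_vector \<Rightarrow> ereal) \<Rightarrow> bool" where
  "ereal_convex g \<longleftrightarrow>
    (\<forall>x y. \<forall>u\<ge>0. \<forall>v\<ge>0. u + v = 1 \<longrightarrow>
      g (u *\<^sub>R x + v *\<^sub>R y) \<le> ereal u * g x + ereal v * g y)"

definition proper_lsc_convex :: "('a::real_normed_vector \<Rightarrow> ereal) \<Rightarrow> bool" where
  "proper_lsc_convex g \<longleftrightarrow> proper g \<and> lower_semicontinuous g \<and> ereal_convex g"

definition subdifferential :: "('a::real_inner \<Rightarrow> ereal) \<Rightarrow> 'a \<Rightarrow> 'a set" where
  "subdifferential g x = {v. \<forall>u. g x + ereal (v \<bullet> (u - x)) \<le> g u}"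

definition conjugate :: "('a::real_inner \<Rightarrow> ereal) \<Rightarrow> 'a \<Rightarrow> ereal" where
  "conjugate g z = (SUP u. ereal (z \<bullet> u) - g u)"

text \<open>Gradient of an extended-real function at a point near which it is finite.\<close>

definition has_gradient :: "('a::real_inner \<Rightarrow> ereal) \<Rightarrow> 'a \<Rightarrow> 'a \<Rightarrow> bool" where
  "has_gradient g y D \<longleftrightarrow>
    (\<forall>\<^sub>F u in nhds y. \<bar>g u\<bar> \<noteq> \<infinity>) \<and> GDERIV (\<lambda>u. real_of_ereal (g u)) y :> D"

definition gradient :: "('a::real_inner \<Rightarrow> ereal) \<Rightarrow> 'a \<Rightarrow> 'a" where
  "gradient g y = (THE D. has_gradient g y D)"

abbreviation is_minimizer :: "('a \<Rightarrow> ereal) \<Rightarrow> 'a \<Rightarrow> bool" where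
  "is_minimizer g \<equiv> is_arg_min g (\<lambda>_. True)"

definition linearization ::
    "('a::real_inner \<Rightarrow> ereal) \<Rightarrow> ('a \<Rightarrow> 'a) \<Rightarrow> 'a \<Rightarrow> 'a \<Rightarrow> ereal" where
  "linearization f f' y u = f y + ereal (f' y \<bullet> (u - y))"

definition prox_term :: "('a::real_inner \<Rightarrow> ereal) \<Rightarrow> real \<Rightarrow> 'a \<Rightarrow> 'a \<Rightarrow> ereal" where
  "prox_term h lam x0 u = h u + ereal (1 / (2 * lam) * (norm (u - x0))\<^sup>2)"

text \<open>
  Algorithms are described by the sequences they generate, indexed by \<open>j \<ge> 1\<close>; values at
  index 0 are irrelevant. In \<open>pdcp_run\<close> the prox center is the separate parameter \<open>x0\<close>.
\<close>

definition pdcp_run ::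
    "('a::real_inner \<Rightarrow> ereal) \<Rightarrow> ('a \<Rightarrow> 'a) \<Rightarrow> ('a \<Rightarrow> ereal) \<Rightarrow> real \<Rightarrow> (nat \<Rightarrow> real) \<Rightarrow> 'a \<Rightarrow>
     (nat \<Rightarrow> 'a \<Rightarrow> ereal) \<Rightarrow> (nat \<Rightarrow> 'a) \<Rightarrow> (nat \<Rightarrow> 'a) \<Rightarrow> bool" where
  "pdcp_run f f' h lam \<tau> x0 \<Gamma> x s \<longleftrightarrow>
    \<Gamma> 1 = linearization f f' x0 \<and>
    (\<forall>j\<ge>1.
      is_minimizer (\<lambda>u. \<Gamma> j u + prox_term h lam x0 u) (x j) \<and>
      s j \<in> subdifferential (\<Gamma> j) (x j) \<inter> uminus ` subdifferential (prox_term h lam x0) (x j) \<and>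
      \<Gamma> (j + 1) =
        (\<lambda>u. ereal (\<tau> j) * \<Gamma> j u + ereal (1 - \<tau> j) * linearization f f' (x j) u))"

definition cg_objective ::
    "('a::real_inner \<Rightarrow> ereal) \<Rightarrow> ('a \<Rightarrow> ereal) \<Rightarrow> real \<Rightarrow> 'a \<Rightarrow> 'a \<Rightarrow> 'a \<Rightarrow> ereal" where
  "cg_objective f h lam x0 y w =
    ereal ((- gradient (conjugate (prox_term h lam x0)) (- y)) \<bullet> w) + conjugate f w"

text \<open>
  The minimizers of the linearized subproblem need not be unique, so a run may use any of them
  as \<open>zbar j\<close>.
\<close>

definition cg_run ::
    "('a::real_inner \<Rightarrow> ereal) \<Rightarrow> ('a \<Rightarrow> ereal) \<Rightarrow> real \<Rightarrow> (nat \<Rightarrow> real) \<Rightarrow> 'a \<Rightarrow> 'a \<Rightarrow>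
     (nat \<Rightarrow> 'a) \<Rightarrow> (nat \<Rightarrow> 'a) \<Rightarrow> bool" where
  "cg_run f h lam \<tau> x0 z1 z zbar \<longleftrightarrow>
    z 1 = z1 \<and>
    (\<forall>j\<ge>1.
      is_minimizer (cg_objective f h lam x0 (z j)) (zbar j) \<and>
      z (j + 1) = \<tau> j *\<^sub>R z j + (1 - \<tau> j) *\<^sub>R zbar j)"

text \<open>
  Tie-breaking by the subgradient oracle: if the oracle's value at the gradient of the conjugate
  is among the minimizers of the subproblem, then it is the one chosen. Nothing is required when it
  is not a minimizer, and the rule holds automatically when minimizers are unique.
\<close>

definition cg_oracle_ties ::
    "('a::real_inner \<Rightarrow> ereal) \<Rightarrow> ('a \<Rightarrow> 'a) \<Rightarrow> ('a \<Rightarrow> ereal) \<Rightarrow> real \<Rightarrow> 'a \<Rightarrow>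
     (nat \<Rightarrow> 'a) \<Rightarrow> (nat \<Rightarrow> 'a) \<Rightarrow> bool" where
  "cg_oracle_ties f f' h lam x0 z zbar \<longleftrightarrow>
    (\<forall>j\<ge>1. let w = f' (gradient (conjugate (prox_term h lam x0)) (- z j)) in
      is_minimizer (cg_objective f h lam x0 (z j)) w \<longrightarrow> zbar j = w)"

text \<open>
  The relation \<open>has_gradient\<close> in the second equation also asserts that the conjugate is
  differentiable there, so that \<open>gradient\<close> is not an arbitrary value.
\<close>

definition pdcp_cg_correspondence ::
    "('a::real_inner \<Rightarrow> 'a) \<Rightarrow> ('a \<Rightarrow> ereal) \<Rightarrow> real \<Rightarrow> 'a \<Rightarrow>
     (nat \<Rightarrow> 'a) \<Rightarrow> (nat \<Rightarrow> 'a) \<Rightarrow> (nat \<Rightarrow> 'a) \<Rightarrow> (nat \<Rightarrow> 'a) \<Rightarrow> bool" where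
  "pdcp_cg_correspondence f' h lam x0 x s z zbar \<longleftrightarrow>
    (\<forall>j\<ge>1.
      s j = z j \<and>
      has_gradient (conjugate (prox_term h lam x0)) (- z j) (x j) \<and>
      x j = gradient (conjugate (prox_term h lam x0)) (- z j) \<and>
      f' (x j) = zbar j)"

end

theory Submission
  imports Defs
begin

text \<open>
  The two schemes coincide because both only manipulate affine minorants of \<open>f\<close>. A one-cut model
  is a convex combination of linearizations of \<open>f\<close>, hence affine; its only subgradient is its
  slope, so \<open>s\<close> obeys the recursion \<open>s (j + 1) = \<tau> j *\<^sub>R s j + (1 - \<tau> j) *\<^sub>R f' (x j)\<close>, which is
  the conditional gradient recursion as soon as \<open>f' (x j)\<close> is the point chosen in the linearized
  dual subproblem (\<open>pdcp_slope_recursion\<close>).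

  The choice is identified in two steps. Optimality of \<open>x j\<close> says that \<open>- s j\<close> is a subgradient
  of the prox-regularized function at \<open>x j\<close>. The quadratic term upgrades the subgradient inequality to
  quadratic growth (\<open>prox_term_quadratic_growth\<close>), and growth of a function at a point is
  smoothness of its conjugate at the corresponding slope: the conjugate is squeezed between an
  affine function with slope \<open>x j\<close> and the same function plus a quadratic, so its gradient at
  \<open>- s j\<close> is \<open>x j\<close> (\<open>has_gradient_conjugate_if_quadratic_growth\<close>). The linearized subproblem
  therefore minimizes the conjugate of \<open>f\<close> minus the linear form of \<open>x j\<close>, and the
  Fenchel--Young inequality, an equality at subgradients, shows that every subgradient of \<open>f\<close> at
  \<open>x j\<close>, in particular \<open>f' (x j)\<close>, is a solution (\<open>subgradient_minimizes_shifted_conjugate\<close>).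
  Solutions may be non-unique; the tie-breaking rule then selects \<open>f' (x j)\<close>, and the sequences
  \<open>s\<close> and \<open>\<lambda>j. f' (x j)\<close> themselves form a run that respects the rule.
\<close>

section \<open>Subgradients and conjugates\<close>

lemma proper_finite_on_domain:
  assumes "proper g" and "y \<in> effective_domain g"
  shows "g y = ereal (real_of_ereal (g y))"
  using assms by (cases "g y") (auto simp: proper_def effective_domain_def)

lemma subdifferential_affine:
  fixes v :: "'a::real_inner"
  shows "subdifferential (\<lambda>u. ereal (c + v \<bullet> u)) y = {v}"
proof -
  have "w = v" if w: "\<forall>u. w \<bullet> (u - y) \<le> v \<bullet> (u - y)" for w
  proof -
    have "(w - v) \<bullet> (w - v) \<le> 0"
      using w[rule_format, of "y + (w - v)"] by (simp add: inner_diff_left)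
    then show ?thesis
      by (metis inner_eq_zero_iff inner_ge_zero order_antisym right_minus_eq)
  qed
  then show ?thesis
    by (auto simp: subdifferential_def inner_diff_right algebra_simps)
qed

lemma fenchel_young: "ereal (w \<bullet> y) - g y \<le> conjugate g w"
  unfolding conjugate_def by (rule SUP_upper) simp

lemma conjugate_eq_at_subgradient:
  assumes v: "v \<in> subdifferential g y" and y: "g y = ereal a"
  shows "conjugate g v = ereal (v \<bullet> y - a)"
proof (rule antisym)
  show "conjugate g v \<le> ereal (v \<bullet> y - a)"
    unfolding conjugate_def
  proof (rule SUP_least)
    fix u
    have "ereal (a + v \<bullet> (u - y)) \<le> g u"
      using v y by (auto simp: subdifferential_def)
    then show "ereal (v \<bullet> u) - g u \<le> ereal (v \<bullet> y - a)"
      by (cases "g u") (auto simp: inner_diff_right)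
  qed
  show "ereal (v \<bullet> y - a) \<le> conjugate g v"
    using fenchel_young[of v y g] y by simp
qed

text \<open>
  By Fenchel--Young the objective is at least \<open>- g y\<close> everywhere, and subgradients attain
  this bound.
\<close>

lemma subgradient_minimizes_shifted_conjugate:
  assumes v: "v \<in> subdifferential g y" and y: "g y = ereal a"
  shows "is_minimizer (\<lambda>w. ereal (- y \<bullet> w) + conjugate g w) v"
proof -
  have "ereal (- y \<bullet> v) + conjugate g v \<le> ereal (- y \<bullet> w) + conjugate g w" for w
    using fenchel_young[of w y g] conjugate_eq_at_subgradient[OF v y] y
    by (cases "conjugate g w") (auto simp: inner_commute)
  then show ?thesis
    unfolding is_arg_min_linorder by simp
qed

lemma gradient_eqI:
  assumes "has_gradient g y D"
  shows "gradient g y = D"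
  unfolding gradient_def
proof (rule the_equality, rule assms)
  fix E
  assume "has_gradient g y E"
  then have "(\<lambda>d. d \<bullet> E) = (\<lambda>d. d \<bullet> D)"
    using assms unfolding has_gradient_def gderiv_def by (blast intro: has_derivative_unique)
  then show "E = D"
    using vector_eq_ldot[of E D] by (simp add: fun_eq_iff)
qed

section \<open>Quadratic growth and differentiability of the conjugate\<close>

lemma power2_norm_convex_combination:
  fixes a b :: "'a::real_inner"
  shows "(norm ((1 - t) *\<^sub>R a + t *\<^sub>R b))\<^sup>2
    = (1 - t) * (norm a)\<^sup>2 + t * (norm b)\<^sup>2 - t * (1 - t) * (norm (b - a))\<^sup>2"
  by (simp add: power2_norm_eq_inner inner_commute[of b a] algebra_simps)

lemma power2_norm_diff_scaled:
  fixes a b :: "'a::real_inner"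
  shows "(norm (a - c *\<^sub>R b))\<^sup>2 = (norm a)\<^sup>2 - 2 * c * (b \<bullet> a) + c\<^sup>2 * (norm b)\<^sup>2"
  unfolding power2_norm_eq_inner
  by (simp add: inner_commute[of b a] power2_eq_square algebra_simps)

text \<open>
  Compare \<open>y\<close> with a point of the segment from \<open>y\<close> to \<open>u\<close>: along it \<open>h\<close> lies below its chord,
  and \<open>\<lambda>p. (norm (p - x0))\<^sup>2\<close> lies below its chord by exactly \<open>t * (1 - t) * (norm (u - y))\<^sup>2\<close>.
  Dividing by \<open>t\<close> and letting \<open>t\<close> tend to zero gives the quadratic gain with its full constant.
\<close>

lemma prox_term_quadratic_growth:
  fixes h :: "'a::real_inner \<Rightarrow> ereal"
  assumes h: "proper h" "ereal_convex h" and y: "y \<in> effective_domain h"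
    and v: "v \<in> subdifferential (prox_term h lam x0) y"
  shows "prox_term h lam x0 y + ereal (v \<bullet> (u - y) + 1 / (2 * lam) * (norm (u - y))\<^sup>2)
    \<le> prox_term h lam x0 u"
proof (cases "h u = \<infinity>")
  case True
  then show ?thesis by (simp add: prox_term_def)
next
  case False
  define k where "k = 1 / (2 * lam)"
  obtain b where b: "h u = ereal b"
    using False h(1) by (cases "h u") (auto simp: proper_def)
  obtain a where a: "h y = ereal a"
    using proper_finite_on_domain[OF h(1) y] by blast
  define gap where
    "gap = b + k * (norm (u - x0))\<^sup>2 - (a + k * (norm (y - x0))\<^sup>2 + v \<bullet> (u - y))"
  have chord: "k * (1 - t) * (norm (u - y))\<^sup>2 \<le> gap" if t: "t > 0" "t < 1" for t
  proof -
    define p where "p = (1 - t) *\<^sub>R y + t *\<^sub>R u"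
    have p: "h p \<le> ereal ((1 - t) * a + t * b)"
      using h(2)[unfolded ereal_convex_def, rule_format, of "1 - t" t y u] t a b
      by (simp add: p_def)
    have py: "p - y = t *\<^sub>R (u - y)"
      by (simp add: p_def algebra_simps)
    have sub: "ereal (a + k * (norm (y - x0))\<^sup>2 + t * (v \<bullet> (u - y))) \<le> prox_term h lam x0 p"
      using v py a by (auto simp: subdifferential_def prox_term_def k_def dest!: spec[of _ p])
    then have "a + k * (norm (y - x0))\<^sup>2 + t * (v \<bullet> (u - y))
        \<le> (1 - t) * a + t * b + k * (norm (p - x0))\<^sup>2"
      using p by (cases "h p") (auto simp: prox_term_def k_def)
    moreover have "(norm (p - x0))\<^sup>2 = (1 - t) * (norm (y - x0))\<^sup>2 + t * (norm (u - x0))\<^sup>2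
        - t * (1 - t) * (norm (u - y))\<^sup>2"
      using power2_norm_convex_combination[of t "y - x0" "u - x0"]
      by (simp add: p_def algebra_simps)
    ultimately have "t * (k * (1 - t) * (norm (u - y))\<^sup>2) \<le> t * gap"
      by (simp add: gap_def algebra_simps)
    then show ?thesis
      using t by simp
  qed
  have "((\<lambda>t. k * (1 - t) * (norm (u - y))\<^sup>2) \<longlongrightarrow> k * (1 - 0) * (norm (u - y))\<^sup>2) (at_right 0)"
    by (intro tendsto_intros)
  moreover have "\<forall>\<^sub>F t in at_right 0. k * (1 - t) * (norm (u - y))\<^sup>2 \<le> gap"
    using chord unfolding eventually_at_right_field by (intro exI[of _ 1]) auto
  ultimately have "k * (norm (u - y))\<^sup>2 \<le> gap"
    using tendsto_upperbound[of _ _ "at_right (0::real)"] by fastforce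
  then show ?thesis
    using a b by (simp add: prox_term_def gap_def k_def algebra_simps)
qed

text \<open>
  Conjugation reverses the growth inequality: the conjugate of the quadratic minorant is the affine
  function \<open>\<lambda>w. v \<bullet> y - a + y \<bullet> (w - v)\<close> plus \<open>lam / 2 * (norm (w - v))\<^sup>2\<close>, while Fenchel--Young at
  \<open>y\<close> bounds the conjugate below by the affine function alone.
\<close>

lemma has_gradient_conjugate_if_quadratic_growth:
  fixes g :: "'a::real_inner \<Rightarrow> ereal"
  assumes lam: "lam > 0" and y: "g y = ereal a"
    and growth: "\<And>u. ereal (a + v \<bullet> (u - y) + 1 / (2 * lam) * (norm (u - y))\<^sup>2) \<le> g u"
  shows "has_gradient (conjugate g) v y"
proof -
  define aff where "aff w = v \<bullet> y - a + y \<bullet> (w - v)" for w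
  have lower: "ereal (aff w) \<le> conjugate g w" for w
    using fenchel_young[of w y g] y by (simp add: aff_def inner_diff_right inner_commute)
  have upper: "conjugate g w \<le> ereal (aff w + lam / 2 * (norm (w - v))\<^sup>2)" for w
    unfolding conjugate_def
  proof (rule SUP_least)
    fix u
    \<comment> \<open>Completing the square bounds the linear form by the quadratic and its conjugate.\<close>
    have "0 \<le> 1 / (2 * lam) * (norm ((u - y) - lam *\<^sub>R (w - v)))\<^sup>2"
      using lam by simp
    also have "\<dots> = 1 / (2 * lam) * (norm (u - y))\<^sup>2 - (w - v) \<bullet> (u - y)
        + lam / 2 * (norm (w - v))\<^sup>2"
      using lam unfolding power2_norm_diff_scaled by (simp add: field_simps power2_eq_square)
    finally have "w \<bullet> u - (a + v \<bullet> (u - y) + 1 / (2 * lam) * (norm (u - y))\<^sup>2)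
        \<le> aff w + lam / 2 * (norm (w - v))\<^sup>2"
      by (simp add: aff_def inner_diff_left inner_diff_right inner_commute)
    then show "ereal (w \<bullet> u) - g u \<le> ereal (aff w + lam / 2 * (norm (w - v))\<^sup>2)"
      using growth[of u] by (cases "g u") auto
  qed
  have finite: "\<bar>conjugate g w\<bar> \<noteq> \<infinity>" for w
    using lower[of w] upper[of w] by auto
  define q where "q w = real_of_ereal (conjugate g w)" for w
  have q: "conjugate g w = ereal (q w)" for w
    using finite[of w] by (auto simp: q_def ereal_real)
  have lower': "aff w \<le> q w" and upper': "q w \<le> aff w + lam / 2 * (norm (w - v))\<^sup>2" for w
    using lower[of w] upper[of w] by (simp_all add: q)
  have qv: "q v = aff v"
    using lower'[of v] upper'[of v] by simp
  have "(q has_derivative (\<lambda>d. d \<bullet> y)) (at v)"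
  proof (rule has_derivativeI_sandwich[of 1 _ _ _ _ "\<lambda>w. lam / 2 * norm (w - v)"])
    show "bounded_linear (\<lambda>d. d \<bullet> y)"
      by (rule bounded_linear_inner_left)
    show "norm (q w - q v - (w - v) \<bullet> y) / norm (w - v) \<le> lam / 2 * norm (w - v)"
      if "w \<noteq> v" for w
      using lower'[of w] upper'[of w] that
      by (simp add: qv aff_def inner_commute power2_eq_square divide_le_eq abs_le_iff)
    have "((\<lambda>w. lam / 2 * norm (w - v)) \<longlongrightarrow> lam / 2 * norm (v - v)) (at v)"
      by (intro tendsto_intros)
    then show "((\<lambda>w. lam / 2 * norm (w - v)) \<longlongrightarrow> 0) (at v)"
      by simp
  qed simp
  then have "GDERIV (\<lambda>w. real_of_ereal (conjugate g w)) v :> y"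
    by (simp add: gderiv_def q_def[abs_def])
  then show ?thesis
    using finite by (simp add: has_gradient_def)
qed

lemma has_gradient_conjugate_prox_term:
  fixes h :: "'a::real_inner \<Rightarrow> ereal"
  assumes h: "proper h" "ereal_convex h" and lam: "lam > 0" and y: "y \<in> effective_domain h"
    and v: "v \<in> subdifferential (prox_term h lam x0) y"
  shows "has_gradient (conjugate (prox_term h lam x0)) v y"
proof -
  obtain a where a: "prox_term h lam x0 y = ereal a"
    using proper_finite_on_domain[OF h(1) y] by (metis plus_ereal.simps(1) prox_term_def)
  show ?thesis
  proof (rule has_gradient_conjugate_if_quadratic_growth[where g = "prox_term h lam x0", OF lam a])
    show "ereal (a + v \<bullet> (u - y) + 1 / (2 * lam) * (norm (u - y))\<^sup>2) \<le> prox_term h lam x0 u" for u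
      using prox_term_quadratic_growth[OF h y v, of u] by (simp add: a add.assoc)
  qed
qed

section \<open>The one-cut models\<close>

lemma linearization_affine:
  assumes "f y = ereal a"
  shows "linearization f f' y = (\<lambda>u. ereal ((a - f' y \<bullet> y) + f' y \<bullet> u))"
  using assms by (auto simp: linearization_def inner_diff_right)

text \<open>
  Iterates of the scheme stay where the oracle is a genuine subgradient: testing the subgradient
  inequality at a point where \<open>h\<close> is finite forces finiteness at the base point.
\<close>

lemma subdifferential_prox_term_domain:
  assumes "proper h" and v: "v \<in> subdifferential (prox_term h lam x0) y"
  shows "y \<in> effective_domain h"
proof -
  obtain u where u: "h u < \<infinity>"
    using assms(1) by (auto simp: proper_def effective_domain_def)
  have "prox_term h lam x0 y + ereal (v \<bullet> (u - y)) \<le> prox_term h lam x0 u"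
    using v by (simp add: subdifferential_def)
  then show ?thesis
    using u by (cases "h y") (auto simp: prox_term_def effective_domain_def)
qed

lemma pdcp_iterate_optimality:
  assumes "pdcp_run f f' h lam \<tau> x0 \<Gamma> x s" and "j \<ge> 1" and "proper h"
  shows "- s j \<in> subdifferential (prox_term h lam x0) (x j)" and "x j \<in> effective_domain h"
proof -
  show "- s j \<in> subdifferential (prox_term h lam x0) (x j)"
    using assms by (auto simp: pdcp_run_def)
  then show "x j \<in> effective_domain h"
    using subdifferential_prox_term_domain assms(3) by blast
qed

lemma pdcp_slope_unique:
  assumes "pdcp_run f f' h lam \<tau> x0 \<Gamma> x s" and "j \<ge> 1"
    and "\<Gamma> j = (\<lambda>u. ereal (c + v \<bullet> u))"
  shows "s j = v"
proof -
  have "s j \<in> subdifferential (\<Gamma> j) (x j)"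
    using assms(1,2) unfolding pdcp_run_def by blast
  then show ?thesis
    by (simp add: assms(3) subdifferential_affine)
qed

lemma pdcp_model_initial:
  assumes run: "pdcp_run f f' h lam \<tau> x0 \<Gamma> x s" and "proper f"
    and "x0 \<in> effective_domain f"
  shows "\<exists>c. \<Gamma> 1 = (\<lambda>u. ereal (c + f' x0 \<bullet> u))"
proof -
  have "\<Gamma> 1 = linearization f f' x0"
    using run unfolding pdcp_run_def by blast
  then show ?thesis
    using linearization_affine[of f x0, OF proper_finite_on_domain[OF assms(2,3)], of f'] by auto
qed

lemma pdcp_model_update:
  assumes run: "pdcp_run f f' h lam \<tau> x0 \<Gamma> x s" and "proper f" and "proper h"
    and dom: "effective_domain h \<subseteq> effective_domain f" and j: "j \<ge> 1"
    and affine: "\<Gamma> j = (\<lambda>u. ereal (c + v \<bullet> u))"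
  shows "\<exists>c. \<Gamma> (j + 1) = (\<lambda>u. ereal (c + (\<tau> j *\<^sub>R v + (1 - \<tau> j) *\<^sub>R f' (x j)) \<bullet> u))"
proof -
  have "x j \<in> effective_domain f"
    using pdcp_iterate_optimality(2)[OF run j \<open>proper h\<close>] dom by blast
  from proper_finite_on_domain[OF \<open>proper f\<close> this]
  obtain a where a: "f (x j) = ereal a"
    by blast
  have "\<Gamma> (j + 1) = (\<lambda>u. ereal (\<tau> j) * \<Gamma> j u + ereal (1 - \<tau> j) * linearization f f' (x j) u)"
    using run j unfolding pdcp_run_def by blast
  also have "\<dots> = (\<lambda>u. ereal ((\<tau> j * c + (1 - \<tau> j) * (a - f' (x j) \<bullet> x j))
      + (\<tau> j *\<^sub>R v + (1 - \<tau> j) *\<^sub>R f' (x j)) \<bullet> u))"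
    by (rule ext)
      (simp add: affine linearization_affine[of f, OF a] algebra_simps)
  finally show ?thesis
    by blast
qed

text \<open>
  Affineness of the model must be carried along the induction: it is what makes the subgradient
  \<open>s j\<close> unique, so that the recursion of the models passes to their slopes.
\<close>

lemma pdcp_model_affine:
  assumes run: "pdcp_run f f' h lam \<tau> x0 \<Gamma> x s" and f: "proper f" and h: "proper h"
    and dom: "effective_domain h \<subseteq> effective_domain f" and x0: "x0 \<in> effective_domain f"
    and "j \<ge> 1"
  shows "\<exists>c. \<Gamma> j = (\<lambda>u. ereal (c + s j \<bullet> u))"
proof -
  have "\<exists>c v. \<Gamma> j = (\<lambda>u. ereal (c + v \<bullet> u))"
    using \<open>j \<ge> 1\<close>
  proof (induction j rule: nat_induct_at_least)
    case base
    show ?case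
      using pdcp_model_initial[OF run f x0] by blast
  next
    case (Suc j)
    then show ?case
      using pdcp_model_update[OF run f h dom Suc.hyps] by (metis Suc_eq_plus1)
  qed
  then show ?thesis
    using pdcp_slope_unique[OF run \<open>j \<ge> 1\<close>] by blast
qed

lemma pdcp_slope_initial:
  assumes run: "pdcp_run f f' h lam \<tau> x0 \<Gamma> x s" and "proper f"
    and "x0 \<in> effective_domain f"
  shows "s 1 = f' x0"
  using pdcp_model_initial[OF assms] pdcp_slope_unique[OF run, of 1] by blast

lemma pdcp_slope_recursion:
  assumes run: "pdcp_run f f' h lam \<tau> x0 \<Gamma> x s" and f: "proper f" and h: "proper h"
    and dom: "effective_domain h \<subseteq> effective_domain f" and x0: "x0 \<in> effective_domain f"
    and j: "j \<ge> 1"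
  shows "s (j + 1) = \<tau> j *\<^sub>R s j + (1 - \<tau> j) *\<^sub>R f' (x j)"
proof -
  obtain c where "\<Gamma> j = (\<lambda>u. ereal (c + s j \<bullet> u))"
    using pdcp_model_affine[OF assms] by blast
  from pdcp_model_update[OF run f h dom j this] show ?thesis
    using pdcp_slope_unique[OF run, of "j + 1"] by auto
qed

section \<open>The correspondence\<close>


theorem theorem3p1:
  fixes f h :: "real ^ 'n \<Rightarrow> ereal"
    and f' :: "real ^ 'n \<Rightarrow> real ^ 'n"
    and M lam :: real
    and \<tau> :: "nat \<Rightarrow> real"
    and x0 z1 :: "real ^ 'n"
    and \<Gamma> :: "nat \<Rightarrow> real ^ 'n \<Rightarrow> ereal"
    and x s :: "nat \<Rightarrow> real ^ 'n"
  assumes "proper_lsc_convex f" and "proper_lsc_convex h"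
    and "effective_domain h \<subseteq> effective_domain f"
    and "\<And>y. y \<in> effective_domain h \<Longrightarrow> f' y \<in> subdifferential f y"
    and "M > 0" and "\<And>y. y \<in> effective_domain h \<Longrightarrow> norm (f' y) \<le> M"
    and "\<exists>y. is_minimizer (\<lambda>u. f u + h u) y"
    and "lam > 0"
    and "x0 \<in> effective_domain h"
    and "z1 = f' x0"
    and "\<And>j. j \<ge> 1 \<Longrightarrow> \<tau> j \<in> {0..1}"
    and "pdcp_run f f' h lam \<tau> x0 \<Gamma> x s"
  shows "(\<exists>z zbar. cg_run f h lam \<tau> x0 z1 z zbar \<and> cg_oracle_ties f f' h lam x0 z zbar) \<and>
    (\<forall>z zbar. cg_run f h lam \<tau> x0 z1 z zbar \<and> cg_oracle_ties f f' h lam x0 z zbar \<longrightarrow>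
      pdcp_cg_correspondence f' h lam x0 x s z zbar)"
proof -
  let ?c = "conjugate (prox_term h lam x0)"
  have f: "proper f" and h: "proper h" "ereal_convex h"
    using assms(1,2) by (auto simp: proper_lsc_convex_def)
  have x0: "x0 \<in> effective_domain f"
    using assms(3,9) by blast
  note run = assms(12)
  note optimal = pdcp_iterate_optimality[OF run _ h(1)]
  have initial: "s 1 = z1"
    using pdcp_slope_initial[OF run f x0] assms(10) by simp
  note recursion = pdcp_slope_recursion[OF run f h(1) assms(3) x0]
  have grad: "has_gradient ?c (- s j) (x j)" if "j \<ge> 1" for j
    using has_gradient_conjugate_prox_term[OF h assms(8)] optimal[OF that] by blast
  note grad_eq = gradient_eqI[OF grad]
  have oracle_optimal: "is_minimizer (cg_objective f h lam x0 (s j)) (f' (x j))"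
    if j: "j \<ge> 1" for j
  proof -
    have "f (x j) = ereal (real_of_ereal (f (x j)))"
      using proper_finite_on_domain[OF f] optimal(2)[OF j] assms(3) by blast
    then have "is_minimizer (\<lambda>w. ereal (- x j \<bullet> w) + conjugate f w) (f' (x j))"
      using subgradient_minimizes_shifted_conjugate assms(4) optimal(2)[OF j] by blast
    then show ?thesis
      by (simp add: cg_objective_def[abs_def] grad_eq[OF j])
  qed
  have "cg_run f h lam \<tau> x0 z1 s (\<lambda>j. f' (x j))"
    using initial recursion oracle_optimal by (simp add: cg_run_def)
  moreover have "cg_oracle_ties f f' h lam x0 s (\<lambda>j. f' (x j))"
    by (simp add: cg_oracle_ties_def grad_eq)
  moreover have "pdcp_cg_correspondence f' h lam x0 x s z zbar"
    if cg: "cg_run f h lam \<tau> x0 z1 z zbar" and ties: "cg_oracle_ties f f' h lam x0 z zbar"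
    for z zbar
  proof -
    have choice: "zbar j = f' (x j)" if j: "j \<ge> 1" and "s j = z j" for j
      using ties oracle_optimal[OF j] grad_eq[OF j] that by (auto simp: cg_oracle_ties_def Let_def)
    have same: "s j = z j" if "j \<ge> 1" for j
      using that
    proof (induction j rule: nat_induct_at_least)
      case base
      show ?case
        using initial cg by (simp add: cg_run_def)
    next
      case (Suc j)
      then show ?case
        using recursion[of j] choice[of j] cg by (simp add: cg_run_def)
    qed
    show ?thesis
      unfolding pdcp_cg_correspondence_def
      using same choice grad grad_eq by auto
  qed
  ultimately show ?thesis
    by blast
qed

end
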